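(* Let $C, A_1,\dots,A_m$ be real symmetric $n \times n$ matrices, let $Z \subseteq \mathbb{Z}^m$, and let $P = \{x \in \mathbb{R}^m : C - \sum_{i=1}^m A_i x_i \succeq 0\}$ be such that the linear matrix inequality $C - \sum_{i=1}^m A_i x_i \succeq 0$ is totally dual integral on $Z$ and satisfies Slater's condition. Let $\mathcal{V} = \{V_1,\dots,V_k\}$ denote the corresponding generating set of integer positive semidefinite matrices (i.e. a finite set witnessing total dual integrality on $Z$), and suppose that $(\langle V_j, A_1\rangle, \dots, \langle V_j, A_m\rangle)^\top \in Z$ for all $j \in [k]$. Define $B \in \mathbb{Z}^{k \times m}$ and $d \in \mathbb{Z}^k$ by $B_{j,i} := \langle A_i, V_j\rangle$ and $d_j := \lfloor \langle C, V_j\rangle \rfloor$ for all $j \in [k]$, $i \in [m]$. Then $$\mathrm{cl}_{CG}(P, Z) = \{x \in \mathbb{R}^m : Bx \le d\}.$$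
   Context: $[k]=\{1,\dots,k\}$, $\langle X,Y\rangle = \mathrm{tr}(X^\top Y)$, and $\succeq 0$ (resp. $\succ 0$) denotes positive semidefinite (resp. positive definite). Slater's condition for the linear matrix inequality (LMI): there is $x \in \mathbb{R}^m$ with $C - \sum_i A_i x_i \succ 0$. Property $(\mathrm{P}\mathbb{Z})_{\mathcal{V}}$: given a finite set $\mathcal{V} = \{V_1,\dots,V_k\}$ of positive semidefinite $n\times n$ matrices with integer entries, a positive semidefinite matrix $X$ satisfies $(\mathrm{P}\mathbb{Z})_{\mathcal{V}}$ if $X = \sum_{j \in [k]} y_j V_j$ for some $y \in \mathbb{Z}^k_+$ (nonnegative integers). Total dual integrality: the LMI $C - \sum_{i=1}^m A_i x_i \succeq 0$ is totally dual integral (TDI) on $Z \subseteq \mathbb{Z}^m$ if there exists a finite set $\mathcal{V}$ of integer positive semidefinite matrices such that, for every $b \in Z$, the dual semidefinite program $\inf\{\langle C, X\rangle : \langle A_i, X\rangle = b_i\ (i \in [m]),\ X \succeq 0\}$ of $\sup\{b^\top x : C - \sum_{i} A_i x_i \succeq 0\}$ has an optimal solution satisfying $(\mathrm{P}\mathbb{Z})_{\mathcal{V}}$ whenever it has an optimal solution. The CG closure of $P$ with respect to $Z$ is $$\mathrm{cl}_{CG}(P,Z) := \bigcap_{\substack{(c,\delta) \in Z \times \mathbb{R} \\ P \subseteq \{x : c^\top x \le \delta\}}} \{x \in \mathbb{R}^m : c^\top x \le \lfloor \delta \rfloor\}.$$ *)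

theory Defs
  imports "HOL-Analysis.Analysis"
begin

definition mat_inner :: "real^'n^'n \<Rightarrow> real^'n^'n \<Rightarrow> real" where
  "mat_inner X Y = trace (transpose X ** Y)"

definition symmetric_mat :: "real^'n^'n \<Rightarrow> bool" where
  "symmetric_mat X \<longleftrightarrow> transpose X = X"

text \<open>Semidefiniteness includes symmetry, so in the dual program below the variable
  ranges over symmetric matrices only.\<close>

definition psd :: "real^'n^'n \<Rightarrow> bool" where
  "psd X \<longleftrightarrow> symmetric_mat X \<and> (\<forall>v. v \<bullet> (X *v v) \<ge> 0)"

definition pos_def :: "real^'n^'n \<Rightarrow> bool" where
  "pos_def X \<longleftrightarrow> symmetric_mat X \<and> (\<forall>v. v \<noteq> 0 \<longrightarrow> v \<bullet> (X *v v) > 0)"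

definition integer_vec :: "real^'m \<Rightarrow> bool" where
  "integer_vec z \<longleftrightarrow> (\<forall>i. z $ i \<in> \<int>)"

definition integer_mat :: "real^'n^'n \<Rightarrow> bool" where
  "integer_mat X \<longleftrightarrow> (\<forall>i j. X $ i $ j \<in> \<int>)"

definition lmi_slack :: "real^'n^'n \<Rightarrow> ('m::finite \<Rightarrow> real^'n^'n) \<Rightarrow> real^'m \<Rightarrow> real^'n^'n" where
  "lmi_slack C A x = C - (\<Sum>i\<in>UNIV. x $ i *\<^sub>R A i)"

definition lmi_set :: "real^'n^'n \<Rightarrow> ('m::finite \<Rightarrow> real^'n^'n) \<Rightarrow> (real^'m) set" where
  "lmi_set C A = {x. psd (lmi_slack C A x)}"

definition slater :: "real^'n^'n \<Rightarrow> ('m::finite \<Rightarrow> real^'n^'n) \<Rightarrow> bool" where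
  "slater C A \<longleftrightarrow> (\<exists>x. pos_def (lmi_slack C A x))"

definition dual_feasible :: "('m::finite \<Rightarrow> real^'n^'n) \<Rightarrow> real^'m \<Rightarrow> (real^'n^'n) set" where
  "dual_feasible A b = {X. (\<forall>i. mat_inner (A i) X = b $ i) \<and> psd X}"

definition dual_optimal ::
    "real^'n^'n \<Rightarrow> ('m::finite \<Rightarrow> real^'n^'n) \<Rightarrow> real^'m \<Rightarrow> real^'n^'n \<Rightarrow> bool" where
  "dual_optimal C A b X \<longleftrightarrow>
     X \<in> dual_feasible A b \<and> (\<forall>Y \<in> dual_feasible A b. mat_inner C X \<le> mat_inner C Y)"

text \<open>The multipliers are indexed by the elements of the (finite) generating set itself.\<close>

definition property_PZ :: "(real^'n^'n) set \<Rightarrow> real^'n^'n \<Rightarrow> bool" where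
  "property_PZ \<V> X \<longleftrightarrow>
     psd X \<and> (\<exists>y :: real^'n^'n \<Rightarrow> nat. X = (\<Sum>V\<in>\<V>. real (y V) *\<^sub>R V))"

definition tdi_generating ::
    "real^'n^'n \<Rightarrow> ('m::finite \<Rightarrow> real^'n^'n) \<Rightarrow> (real^'m) set \<Rightarrow> (real^'n^'n) set \<Rightarrow> bool" where
  "tdi_generating C A Z \<V> \<longleftrightarrow>
     finite \<V> \<and> (\<forall>V\<in>\<V>. psd V \<and> integer_mat V) \<and>
     (\<forall>b\<in>Z. (\<exists>X. dual_optimal C A b X) \<longrightarrow> (\<exists>X. dual_optimal C A b X \<and> property_PZ \<V> X))"

definition tdi_on ::
    "real^'n^'n \<Rightarrow> ('m::finite \<Rightarrow> real^'n^'n) \<Rightarrow> (real^'m) set \<Rightarrow> bool" where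
  "tdi_on C A Z \<longleftrightarrow> (\<exists>\<V>. tdi_generating C A Z \<V>)"

definition cg_closure :: "(real^'m) set \<Rightarrow> (real^'m) set \<Rightarrow> (real^'m) set" where
  "cg_closure P Z =
     (\<Inter>(c, \<delta>) \<in> {(c, \<delta>). c \<in> Z \<and> P \<subseteq> {x. c \<bullet> x \<le> \<delta>}}. {x. c \<bullet> x \<le> real_of_int \<lfloor>\<delta>\<rfloor>})"

end

theory Submission
  imports Defs
begin

text \<open>The inclusion of the closure in the polyhedron is weak duality: each \<open>V j\<close> is dual feasible
  for the right-hand side \<open>B j\<close>, so \<open>B j \<bullet> x \<le> \<langle>C, V j\<rangle>\<close> is valid on \<open>P\<close>.
  Conversely, let \<open>c \<bullet> x \<le> \<delta>\<close> be valid on \<open>P\<close> with \<open>c \<in> Z\<close>. Slater's condition makes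
  the dual optimum attained with value at most \<open>\<delta>\<close>, and total dual integrality provides
  an optimal solution that is a nonnegative integer combination of the \<open>V j\<close>. The same combination of the
  inequalities \<open>B j \<bullet> x \<le> d j\<close> is \<open>c \<bullet> x \<le> t\<close> for an integer \<open>t \<le> \<delta>\<close>.\<close>

section \<open>Trace inner product, rank-one matrices and symmetric matrices\<close>

lemma mat_inner_eq_inner: "mat_inner X Y = X \<bullet> Y"
proof -
  have "mat_inner X Y = (\<Sum>i\<in>UNIV. \<Sum>j\<in>UNIV. X $ j $ i * Y $ j $ i)"
    by (simp add: mat_inner_def trace_def transpose_def matrix_matrix_mult_def)
  also have "\<dots> = (\<Sum>j\<in>UNIV. \<Sum>i\<in>UNIV. X $ j $ i * Y $ j $ i)"
    by (rule sum.swap)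
  finally show ?thesis
    by (simp add: inner_vec_def)
qed

lemma inner_transpose_transpose: "transpose X \<bullet> transpose Y = X \<bullet> (Y :: real^'n^'m)"
  unfolding inner_vec_def transpose_def by simp (rule sum.swap)

definition outer_product :: "real^'n \<Rightarrow> real^'n \<Rightarrow> real^'n^'n" where
  "outer_product u v = (\<chi> i j. u $ i * v $ j)"

lemma inner_outer_product: "X \<bullet> outer_product u v = u \<bullet> (X *v v)"
  by (simp add: inner_vec_def outer_product_def matrix_vector_mult_def sum_distrib_left
      mult.left_commute)

lemma outer_product_mult_vec: "outer_product u v *v w = (v \<bullet> w) *\<^sub>R u"
  by (vector inner_vec_def outer_product_def matrix_vector_mult_def sum_distrib_right sum_distrib_left mult_ac)

lemma symmetric_mat_outer_product: "symmetric_mat (outer_product v v)"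
  by (simp add: symmetric_mat_def transpose_def outer_product_def vec_eq_iff mult.commute)

lemma symmetric_mat_diff: "symmetric_mat X \<Longrightarrow> symmetric_mat Y \<Longrightarrow> symmetric_mat (X - Y)"
  by (simp add: symmetric_mat_def transpose_def vec_eq_iff)

lemma symmetric_mat_scaleR: "symmetric_mat X \<Longrightarrow> symmetric_mat (r *\<^sub>R X)"
  by (simp add: symmetric_mat_def transpose_def vec_eq_iff)

lemma symmetric_mat_sum: "(\<And>i. i \<in> I \<Longrightarrow> symmetric_mat (X i)) \<Longrightarrow> symmetric_mat (\<Sum>i\<in>I. X i)"
  by (simp add: symmetric_mat_def transpose_def vec_eq_iff)

lemma symmetric_mat_inner: "symmetric_mat X \<Longrightarrow> u \<bullet> (X *v v) = v \<bullet> (X *v u)"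
  by (metis dot_lmul_matrix inner_commute symmetric_mat_def transpose_matrix_vector)

lemma symmetric_mat_lmi_slack:
  assumes "symmetric_mat C" "\<And>i. symmetric_mat (A i)"
  shows "symmetric_mat (lmi_slack C A x)"
  unfolding lmi_slack_def
  by (intro symmetric_mat_diff symmetric_mat_sum symmetric_mat_scaleR assms)

section \<open>Quadratic forms of semidefinite and definite matrices\<close>

lemma psd_quadratic_shift:
  assumes "psd X"
  shows "0 \<le> v \<bullet> (X *v v) - 2 * t * (u \<bullet> (X *v v)) + t\<^sup>2 * (u \<bullet> (X *v u))"
proof -
  have "0 \<le> (v - t *\<^sub>R u) \<bullet> (X *v (v - t *\<^sub>R u))"
    using assms unfolding psd_def by blast
  moreover have "v \<bullet> (X *v u) = u \<bullet> (X *v v)"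
    using assms symmetric_mat_inner unfolding psd_def by blast
  ultimately show ?thesis
    by (simp add: matrix_vector_mult_diff_distrib matrix_vector_mult_scaleR inner_diff_left inner_diff_right
        algebra_simps power2_eq_square)
qed

text \<open>When the form of \<open>X\<close> vanishes at \<open>u\<close>, the expression in
  \<open>psd_quadratic_shift\<close> is affine in \<open>t\<close>; being nonnegative for every
  \<open>t\<close>, it has slope zero.\<close>

lemma psd_isotropic_imp_kernel:
  assumes "psd X" "u \<bullet> (X *v u) = 0"
  shows "X *v u = 0"
proof -
  have "u \<bullet> (X *v v) = 0" for v
  proof (rule ccontr)
    define a where "a = u \<bullet> (X *v v)"
    assume "u \<bullet> (X *v v) \<noteq> 0"
    then have "a \<noteq> 0" by (simp add: a_def)
    \<comment> \<open>This choice of \<open>t\<close> makes the shifted form equal to -1.\<close>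
    then show False
      using psd_quadratic_shift[OF assms(1), of v "(v \<bullet> (X *v v) + 1) / (2 * a)" u] assms(2)
      by (simp add: a_def[symmetric])
  qed
  then have "(X *v u) \<bullet> (X *v u) = 0"
    using assms(1) symmetric_mat_inner unfolding psd_def by metis
  then show ?thesis by simp
qed

text \<open>Symmetric Gaussian elimination: it splits off a rank-one positive semidefinite matrix.\<close>

lemma psd_deflate:
  assumes "psd X" "u \<bullet> (X *v u) > 0"
  shows "psd (X - (1 / (u \<bullet> (X *v u))) *\<^sub>R outer_product (X *v u) (X *v u))"
  unfolding psd_def
proof (intro conjI allI)
  let ?a = "u \<bullet> (X *v u)"
  show "symmetric_mat (X - (1 / ?a) *\<^sub>R outer_product (X *v u) (X *v u))"
    using assms(1) unfolding psd_def
    by (intro symmetric_mat_diff symmetric_mat_scaleR symmetric_mat_outer_product) auto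
  fix v
  define b where "b = u \<bullet> (X *v v)"
  have "v \<bullet> (X *v u) = b"
    unfolding b_def using assms(1) symmetric_mat_inner unfolding psd_def by blast
  then have "v \<bullet> ((X - (1 / ?a) *\<^sub>R outer_product (X *v u) (X *v u)) *v v) = v \<bullet> (X *v v) - b\<^sup>2 / ?a"
    by (simp add: matrix_vector_mult_diff_rdistrib scaleR_matrix_vector_assoc[symmetric]
        outer_product_mult_vec inner_diff_right inner_commute power2_eq_square)
  \<comment> \<open>Completing the square: this is the shifted form at its minimiser
    \<open>t = b / ?a\<close>.\<close>
  also have "\<dots> = v \<bullet> (X *v v) - 2 * (b / ?a) * b + (b / ?a)\<^sup>2 * ?a"
    using assms(2) by (simp add: field_simps power2_eq_square)
  also have "\<dots> \<ge> 0"
    using psd_quadratic_shift[OF assms(1), of v "b / ?a" u] by (simp add: b_def)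
  finally show "0 \<le> v \<bullet> ((X - (1 / ?a) *\<^sub>R outer_product (X *v u) (X *v u)) *v v)" .
qed

text \<open>Induction on a set \<open>I\<close> containing the indices of all nonzero columns of
  \<open>X\<close>. Deflating along an axis vector clears one column, and the rank-one part split
  off pairs with \<open>Y\<close> to a value of the quadratic form of \<open>Y\<close>. This stands
  in for a spectral decomposition.\<close>

lemma psd_inner_nonneg_supported:
  fixes X Y :: "real^'n^'n"
  assumes "finite I" "psd X" "\<And>i. i \<notin> I \<Longrightarrow> X *v axis i 1 = 0" "psd Y"
  shows "X \<bullet> Y \<ge> 0"
  using assms(1-3)
proof (induction I arbitrary: X rule: finite_induct)
  case empty
  have "X $ i $ j = 0" for i j
    using empty.prems(2)[of j] by (simp add: matrix_vector_mul_component vec_eq_iff inner_axis)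
  then have "X = 0" by (simp add: vec_eq_iff)
  then show ?case by simp
next
  case (insert i I)
  define u :: "real^'n" where "u = axis i 1"
  define a where "a = u \<bullet> (X *v u)"
  have "a \<ge> 0" using insert.prems(1) by (simp add: a_def psd_def)
  show ?case
  proof (cases "a = 0")
    case True
    then have "X *v u = 0"
      using psd_isotropic_imp_kernel insert.prems(1) unfolding a_def by blast
    then have "X *v axis j 1 = 0" if "j \<notin> I" for j
      using that insert.prems(2)[of j] u_def by auto
    then show ?thesis using insert.IH insert.prems(1) by blast
  next
    case False
    with \<open>a \<ge> 0\<close> have "a > 0" by simp
    define X' where "X' = X - (1 / a) *\<^sub>R outer_product (X *v u) (X *v u)"
    have mv: "X' *v w = X *v w - (((X *v u) \<bullet> w) / a) *\<^sub>R (X *v u)" for w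
      by (simp add: X'_def matrix_vector_mult_diff_rdistrib scaleR_matrix_vector_assoc[symmetric]
        outer_product_mult_vec)
    have "X' *v axis j 1 = 0" if "j \<notin> I" for j
    proof (cases "j = i")
      case True
      then show ?thesis
        using mv[of u] \<open>a > 0\<close> by (simp add: a_def inner_commute u_def)
    next
      case False
      then have "X *v axis j 1 = 0" using that insert.prems(2) by auto
      \<comment> \<open>By symmetry the correction term also vanishes on a zero column, so such
        columns stay zero.\<close>
      moreover have "(X *v u) \<bullet> axis j 1 = u \<bullet> (X *v axis j 1)"
        using insert.prems(1) symmetric_mat_inner unfolding psd_def by (metis inner_commute)
      ultimately show ?thesis by (simp add: mv)
    qed
    moreover have "psd X'"
      using psd_deflate insert.prems(1) \<open>a > 0\<close> unfolding X'_def a_def by blast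
    ultimately have "X' \<bullet> Y \<ge> 0" using insert.IH by blast
    moreover have "outer_product (X *v u) (X *v u) \<bullet> Y \<ge> 0"
      using \<open>psd Y\<close> by (simp add: inner_commute[of _ Y] inner_outer_product psd_def)
    moreover have "X \<bullet> Y = X' \<bullet> Y + (1 / a) * (outer_product (X *v u) (X *v u) \<bullet> Y)"
      by (simp add: X'_def inner_diff_left)
    ultimately show ?thesis using \<open>a > 0\<close> by simp
  qed
qed

lemma psd_inner_nonneg: "psd X \<Longrightarrow> psd Y \<Longrightarrow> X \<bullet> Y \<ge> 0"
  using psd_inner_nonneg_supported[of UNIV X Y] by simp

text \<open>The form of \<open>S\<close> attains a minimum \<open>\<mu> > 0\<close> on the compact
  unit sphere, while that of \<open>X\<close> is at most \<open>K\<close> there; hence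
  \<open>e = \<mu> / K\<close>.\<close>

lemma pos_def_absorbs:
  fixes S X :: "real^'n^'n"
  assumes "pos_def S"
  obtains e where "e > 0" "\<And>v. v \<bullet> ((S - e *\<^sub>R X) *v v) \<ge> 0"
proof -
  have "continuous_on (sphere 0 1) (\<lambda>v. v \<bullet> (S *v v))"
    by (intro continuous_intros)
  moreover have "sphere (0::real^'n) 1 \<noteq> {}" by simp
  ultimately obtain w where w: "w \<in> sphere 0 1"
    and wmin: "\<And>v. v \<in> sphere 0 1 \<Longrightarrow> w \<bullet> (S *v w) \<le> v \<bullet> (S *v v)"
    using continuous_attains_inf[OF compact_sphere] by blast
  define \<mu> where "\<mu> = w \<bullet> (S *v w)"
  have "\<mu> > 0" using assms w unfolding \<mu>_def pos_def_def by (metis dist_0_norm mem_sphere norm_zero zero_neq_one)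
  have lower: "\<mu> * (norm v)\<^sup>2 \<le> v \<bullet> (S *v v)" for v
  proof (cases "v = 0")
    case False
    then have "\<mu> \<le> (v /\<^sub>R norm v) \<bullet> (S *v (v /\<^sub>R norm v))"
      unfolding \<mu>_def by (intro wmin) simp
    also have "\<dots> = (v \<bullet> (S *v v)) / (norm v)\<^sup>2"
      by (simp add: matrix_vector_mult_scaleR power2_eq_square divide_inverse)
    finally show ?thesis using False by (simp add: field_simps)
  qed simp
  obtain K where K: "K > 0" "\<And>v. norm (X *v v) \<le> K * norm v"
    using linear_bounded_pos[OF matrix_vector_mul_linear[of X]] by blast
  have upper: "v \<bullet> (X *v v) \<le> K * (norm v)\<^sup>2" for v
  proof -
    have "v \<bullet> (X *v v) \<le> norm v * norm (X *v v)" by (rule norm_cauchy_schwarz)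
    also have "\<dots> \<le> norm v * (K * norm v)" by (intro mult_left_mono K) simp
    finally show ?thesis by (simp add: power2_eq_square mult_ac)
  qed
  show ?thesis
  proof
    show "\<mu> / K > 0" using \<open>\<mu> > 0\<close> K by simp
    fix v
    have "\<mu> / K * (v \<bullet> (X *v v)) \<le> \<mu> / K * (K * (norm v)\<^sup>2)"
      using \<open>\<mu> > 0\<close> K(1) by (intro mult_left_mono upper) simp
    also have "\<dots> \<le> v \<bullet> (S *v v)" using lower[of v] K(1) by simp
    finally show "v \<bullet> ((S - (\<mu> / K) *\<^sub>R X) *v v) \<ge> 0"
      by (simp add: matrix_vector_mult_diff_rdistrib scaleR_matrix_vector_assoc[symmetric]
          inner_diff_right)
  qed
qed

section \<open>Weak and strong duality for the linear matrix inequality\<close>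

lemma inner_lmi_slack:
  fixes c :: "real^'m::finite"
  assumes "\<And>i. A i \<bullet> X = c $ i"
  shows "lmi_slack C A x \<bullet> X = C \<bullet> X - c \<bullet> x"
proof -
  have "c \<bullet> x = (\<Sum>i\<in>UNIV. x $ i * c $ i)"
    by (simp add: inner_vec_def mult.commute)
  then show ?thesis
    by (simp add: lmi_slack_def inner_diff_left inner_sum_left assms)
qed

text \<open>The duality gap is the inner product of two semidefinite matrices, the slack and
  \<open>X\<close>.\<close>

lemma weak_duality:
  assumes "x \<in> lmi_set C A" "X \<in> dual_feasible A b"
  shows "b \<bullet> x \<le> mat_inner C X"
proof -
  have "\<And>i. A i \<bullet> X = b $ i" and "psd X"
    using assms(2) by (auto simp: dual_feasible_def mat_inner_eq_inner)
  moreover have "psd (lmi_slack C A x)" using assms(1) by (simp add: lmi_set_def)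
  ultimately show ?thesis
    using psd_inner_nonneg[of "lmi_slack C A x" X] by (simp add: inner_lmi_slack mat_inner_eq_inner)
qed

text \<open>A hyperplane separates the pairs (slack, \<open>c \<bullet> x - \<delta>\<close>) from
  \<open>Q \<times> {0<..}\<close>. Its normal is \<open>(X, \<tau>)\<close>; Slater's condition
  excludes \<open>\<tau> = 0\<close>, and \<open>X\<close> divided by \<open>\<tau>\<close> is the
  dual solution.\<close>

lemma strong_duality:
  fixes C :: "real^'n^'n" and A :: "'m::finite \<Rightarrow> real^'n^'n"
  assumes sym: "symmetric_mat C" "\<And>i. symmetric_mat (A i)"
    and slater: "slater C A"
    and valid: "\<And>x. x \<in> lmi_set C A \<Longrightarrow> c \<bullet> x \<le> \<delta>"
  obtains X where "X \<in> dual_feasible A c" "mat_inner C X \<le> \<delta>"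
proof -
  \<comment> \<open>Not restricting \<open>Q\<close> to symmetric matrices forces the multiplier \<open>X\<close> to be symmetric and rules out
    a degenerate separation.\<close>
  define Q where "Q = {M :: real^'n^'n. \<forall>v. v \<bullet> (M *v v) \<ge> 0}"
  define S where "S = range (\<lambda>x. (lmi_slack C A x, c \<bullet> x - \<delta>))"
  define T where "T = Q \<times> {0::real<..}"
  have addQ: "M + N \<in> Q" if "M \<in> Q" "N \<in> Q" for M N
    using that by (simp add: Q_def matrix_vector_mult_add_rdistrib inner_add_right)
  have scaleQ: "r *\<^sub>R M \<in> Q" if "M \<in> Q" "r \<ge> 0" for r :: real and M
    using that by (simp add: Q_def scaleR_matrix_vector_assoc[symmetric])
  have zeroQ: "0 \<in> Q" by (simp add: Q_def)
  have "convex Q"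
    by (intro convexI addQ scaleQ)
  then have "convex T"
    unfolding T_def by (intro convex_Times convex_real_interval)
  have slack_add: "lmi_slack C A (u *\<^sub>R x + v *\<^sub>R y) = u *\<^sub>R lmi_slack C A x + v *\<^sub>R lmi_slack C A y"
    if "u + v = 1" for u v :: real and x y
  proof -
    have "C = u *\<^sub>R C + v *\<^sub>R C" using that by (metis scaleR_add_left scaleR_one)
    then show ?thesis
      by (simp add: lmi_slack_def algebra_simps sum.distrib scaleR_sum_right)
  qed
  have "convex S"
  proof (rule convexI)
    fix p q u v assume "p \<in> S" "q \<in> S" and uv: "0 \<le> (u::real)" "0 \<le> (v::real)" "u + v = 1"
    then obtain x y where "p = (lmi_slack C A x, c \<bullet> x - \<delta>)" "q = (lmi_slack C A y, c \<bullet> y - \<delta>)"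
      by (auto simp: S_def)
    moreover have "\<delta> = u * \<delta> + v * \<delta>" using uv(3) by (metis distrib_right mult_1)
    ultimately have "u *\<^sub>R p + v *\<^sub>R q
        = (lmi_slack C A (u *\<^sub>R x + v *\<^sub>R y), c \<bullet> (u *\<^sub>R x + v *\<^sub>R y) - \<delta>)"
      by (simp add: slack_add[OF uv(3)] inner_add_right algebra_simps)
    then show "u *\<^sub>R p + v *\<^sub>R q \<in> S" by (simp add: S_def)
  qed
  have "S \<inter> T = {}"
  proof -
    \<comment> \<open>Slacks are symmetric, so one lying in \<open>Q\<close> is semidefinite and
      \<open>x\<close> is feasible.\<close>
    have "c \<bullet> x - \<delta> \<le> 0" if "lmi_slack C A x \<in> Q" for x
      using that valid[of x] symmetric_mat_lmi_slack[of C A x] sym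
      by (simp add: lmi_set_def psd_def Q_def)
    then show ?thesis by (force simp: S_def T_def)
  qed
  moreover have "S \<noteq> {}" by (simp add: S_def)
  moreover have "T \<noteq> {}" using zeroQ by (auto simp: T_def)
  ultimately obtain p \<beta> where p: "p \<noteq> 0" "\<And>s. s \<in> S \<Longrightarrow> p \<bullet> s \<le> \<beta>" "\<And>t. t \<in> T \<Longrightarrow> p \<bullet> t \<ge> \<beta>"
    using separating_hyperplane_sets[OF \<open>convex S\<close> \<open>convex T\<close>] by blast
  obtain X \<tau> where X: "p = (X, \<tau>)" by (cases p)
  have pS: "X \<bullet> lmi_slack C A x + \<tau> * (c \<bullet> x - \<delta>) \<le> \<beta>" for x
    using p(2)[of "(lmi_slack C A x, c \<bullet> x - \<delta>)"] by (simp add: S_def X)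
  have pT: "X \<bullet> M + \<tau> * r \<ge> \<beta>" if "M \<in> Q" "r > 0" for M r
    using p(3)[of "(M, r)"] that by (simp add: T_def X)
  \<comment> \<open>A linear function bounded below on the positive ray has nonnegative slope: the
    point chosen below would give the value \<open>- (\<bar>\<gamma>\<bar> + 1)\<close>, which is
    less than \<open>\<gamma>\<close>.\<close>
  have nonneg_mult: "\<xi> \<ge> 0" if "\<And>r::real. r > 0 \<Longrightarrow> \<xi> * r \<ge> \<gamma>" for \<xi> \<gamma> :: real
  proof (rule ccontr)
    assume "\<not> \<xi> \<ge> 0"
    then have pos: "(\<bar>\<gamma>\<bar> + 1) / (- \<xi>) > 0"
      and eq: "\<xi> * ((\<bar>\<gamma>\<bar> + 1) / (- \<xi>)) = - (\<bar>\<gamma>\<bar> + 1)"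
      by (simp_all add: divide_pos_neg)
    show False
      using that[OF pos] unfolding eq by linarith
  qed
  have "\<tau> \<ge> 0"
    by (rule nonneg_mult[of \<beta>]) (use pT[OF zeroQ] in simp)
  have XQ: "X \<bullet> M \<ge> 0" if "M \<in> Q" for M
  proof (rule nonneg_mult[of "\<beta> - \<tau>"])
    fix r :: real assume "r > 0"
    then show "\<beta> - \<tau> \<le> X \<bullet> M * r"
      using pT[OF scaleQ[OF that, of r], of 1] by (simp add: mult.commute)
  qed
  \<comment> \<open>Let the point \<open>(0, r)\<close> of \<open>T\<close> tend to the origin; the
    denominator \<open>\<tau> + 1\<close> also covers \<open>\<tau> = 0\<close>.\<close>
  have "\<beta> \<le> 0"
  proof (rule field_le_epsilon)
    fix e :: real assume "e > 0"
    have "\<tau> * (e / (\<tau> + 1)) \<le> e"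
      using \<open>\<tau> \<ge> 0\<close> \<open>e > 0\<close> by (simp add: field_simps)
    then show "\<beta> \<le> 0 + e"
      using pT[OF zeroQ, of "e / (\<tau> + 1)"] \<open>\<tau> \<ge> 0\<close> \<open>e > 0\<close> by simp
  qed
  \<comment> \<open>The form of a skew matrix is zero, so this is a legal test matrix. Pairing it
    with \<open>X\<close> bounds the squared norm of \<open>transpose X - X\<close> by 0.\<close>
  have "transpose X - X \<in> Q"
  proof -
    have "v \<bullet> (transpose X *v v) = v \<bullet> (X *v v)" for v
      by (metis dot_lmul_matrix inner_commute transpose_matrix_vector)
    then show ?thesis
      by (simp add: Q_def matrix_vector_mult_diff_rdistrib inner_diff_right)
  qed
  then have "X \<bullet> transpose X \<ge> X \<bullet> X"
    using XQ[of "transpose X - X"] by (simp add: inner_diff_right)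
  then have "(transpose X - X) \<bullet> (transpose X - X) \<le> 0"
    using inner_transpose_transpose[of X X] by (simp add: inner_diff_right inner_diff_left inner_commute)
  then have "symmetric_mat X"
    by (metis symmetric_mat_def inner_eq_zero_iff inner_ge_zero order.antisym right_minus_eq)
  moreover have "v \<bullet> (X *v v) \<ge> 0" for v
  proof -
    have "outer_product v v \<in> Q"
      by (simp add: Q_def outer_product_mult_vec inner_commute)
    then show ?thesis using XQ inner_outer_product by metis
  qed
  ultimately have "psd X" by (simp add: psd_def)
  \<comment> \<open>If \<open>\<tau> = 0\<close>, then \<open>X\<close> is nonzero and its product
    with a Slater slack is at least \<open>e * (X \<bullet> X) > 0\<close>, whereas separation
    bounds that product by \<open>\<beta> \<le> 0\<close>.\<close>
  have "\<tau> \<noteq> 0"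
  proof
    assume "\<tau> = 0"
    with p(1) X have "X \<noteq> 0" by (auto simp: zero_prod_def)
    obtain x where x: "pos_def (lmi_slack C A x)" using slater by (auto simp: slater_def)
    obtain e where e: "e > 0" "lmi_slack C A x - e *\<^sub>R X \<in> Q"
      using pos_def_absorbs[OF x, of X] unfolding Q_def by blast
    have "e * (X \<bullet> X) \<le> X \<bullet> lmi_slack C A x"
      using XQ[OF e(2)] by (simp add: inner_diff_right)
    also have "\<dots> \<le> 0" using pS[of x] \<open>\<tau> = 0\<close> \<open>\<beta> \<le> 0\<close> by simp
    finally show False using e(1) \<open>X \<noteq> 0\<close> by (metis inner_gt_zero_iff mult_pos_pos not_le)
  qed
  with \<open>\<tau> \<ge> 0\<close> have "\<tau> > 0" by simp
  define a :: "real^'m" where "a = (\<chi> i. A i \<bullet> X)"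
  have lin: "(C \<bullet> X - \<tau> * \<delta>) + (\<tau> *\<^sub>R c - a) \<bullet> x \<le> 0" for x
    using pS[of x] \<open>\<beta> \<le> 0\<close> inner_lmi_slack[of A X a C x]
    by (simp add: a_def inner_commute inner_diff_left inner_diff_right algebra_simps)
  define g where "g = \<tau> *\<^sub>R c - a"
  \<comment> \<open>By \<open>lin\<close>, an affine function with gradient \<open>g\<close> is
    bounded above on the whole space; a multiple of \<open>g\<close> as argument would outweigh its
    constant term.\<close>
  have "g = 0"
  proof (rule ccontr)
    assume "g \<noteq> 0"
    then have "g \<bullet> ((((\<bar>C \<bullet> X - \<tau> * \<delta>\<bar> + 1) / (g \<bullet> g))) *\<^sub>R g) = \<bar>C \<bullet> X - \<tau> * \<delta>\<bar> + 1"
      by simp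
    then show False using lin[of "(((\<bar>C \<bullet> X - \<tau> * \<delta>\<bar> + 1) / (g \<bullet> g))) *\<^sub>R g"]
      unfolding g_def[symmetric] by linarith
  qed
  then have "A i \<bullet> X = \<tau> * c $ i" for i
    by (auto simp: g_def a_def vec_eq_iff)
  moreover have "psd ((1 / \<tau>) *\<^sub>R X)"
    using \<open>psd X\<close> \<open>\<tau> > 0\<close>
    by (simp add: psd_def symmetric_mat_scaleR scaleR_matrix_vector_assoc[symmetric])
  ultimately have "(1 / \<tau>) *\<^sub>R X \<in> dual_feasible A c"
    using \<open>\<tau> > 0\<close> by (simp add: dual_feasible_def mat_inner_eq_inner)
  moreover have "mat_inner C ((1 / \<tau>) *\<^sub>R X) \<le> \<delta>"
    using lin[of 0] \<open>\<tau> > 0\<close> by (simp add: mat_inner_eq_inner field_simps)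
  ultimately show ?thesis using that by blast
qed

text \<open>Strong duality with the primal supremum \<open>s\<close> as bound yields a feasible
  \<open>X\<close> of value at most \<open>s\<close>, and weak duality shows that no feasible value
  is below \<open>s\<close>.\<close>

lemma dual_optimal_exists:
  fixes C :: "real^'n^'n" and A :: "'m::finite \<Rightarrow> real^'n^'n"
  assumes sym: "symmetric_mat C" "\<And>i. symmetric_mat (A i)"
    and slater: "slater C A"
    and valid: "\<And>x. x \<in> lmi_set C A \<Longrightarrow> c \<bullet> x \<le> \<delta>"
  obtains X where "dual_optimal C A c X"
proof -
  have ne: "lmi_set C A \<noteq> {}"
  proof -
    obtain x where "pos_def (lmi_slack C A x)" using slater by (auto simp: slater_def)
    then have "psd (lmi_slack C A x)"
      unfolding psd_def pos_def_def by (metis inner_zero_left order.refl less_imp_le)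
    then show ?thesis by (auto simp: lmi_set_def)
  qed
  define s where "s = (SUP x\<in>lmi_set C A. c \<bullet> x)"
  have bdd: "bdd_above ((\<lambda>x. c \<bullet> x) ` lmi_set C A)"
    using valid by (rule bdd_aboveI2)
  have "c \<bullet> x \<le> s" if "x \<in> lmi_set C A" for x
    unfolding s_def by (rule cSUP_upper[OF that bdd])
  then obtain X where X: "X \<in> dual_feasible A c" "mat_inner C X \<le> s"
    using strong_duality[OF sym slater] by blast
  moreover have "s \<le> mat_inner C Y" if "Y \<in> dual_feasible A c" for Y
    unfolding s_def using ne weak_duality that by (intro cSUP_least)
  ultimately show ?thesis
    using that[of X] unfolding dual_optimal_def by force
qed

section \<open>The Chvatal-Gomory closure as a rational polyhedron\<close>

theorem theorem5:
  fixes C :: "real^'n^'n"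
    and A :: "'m::finite \<Rightarrow> real^'n^'n"
    and Z :: "(real^'m) set"
    and P :: "(real^'m) set"
    and k :: nat
    and V :: "nat \<Rightarrow> real^'n^'n"
    and B :: "nat \<Rightarrow> real^'m"
    and d :: "nat \<Rightarrow> int"
  assumes "symmetric_mat C"
    and "\<And>i. symmetric_mat (A i)"
    and "\<And>z. z \<in> Z \<Longrightarrow> integer_vec z"
    and "P = lmi_set C A"
    and "tdi_on C A Z"
    and "slater C A"
    and "tdi_generating C A Z (V ` {1..k})"
    and "\<And>j. j \<in> {1..k} \<Longrightarrow> (\<chi> i. mat_inner (V j) (A i)) \<in> Z"
    and "\<And>j i. j \<in> {1..k} \<Longrightarrow> B j $ i = mat_inner (A i) (V j)"
    and "\<And>j. j \<in> {1..k} \<Longrightarrow> d j = \<lfloor>mat_inner C (V j)\<rfloor>"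
  shows "(\<forall>j\<in>{1..k}. integer_vec (B j)) \<and>
         cg_closure P Z = {x. \<forall>j\<in>{1..k}. B j \<bullet> x \<le> real_of_int (d j)}"
proof -
  have B_eq: "B j = (\<chi> i. mat_inner (V j) (A i))" if "j \<in> {1..k}" for j
    using assms(9)[OF that] by (simp add: vec_eq_iff mat_inner_eq_inner inner_commute)
  have B_Z: "B j \<in> Z" if "j \<in> {1..k}" for j
    using assms(8)[OF that] B_eq[OF that] by simp
  have B_int: "integer_vec (B j)" if "j \<in> {1..k}" for j
    using assms(3) B_Z that by blast
  have psd_V: "psd (V j)" if "j \<in> {1..k}" for j
    using assms(7) that by (simp add: tdi_generating_def)
  have "cg_closure P Z \<subseteq> {x. \<forall>j\<in>{1..k}. B j \<bullet> x \<le> real_of_int (d j)}"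
  proof clarify
    fix x j assume x: "x \<in> cg_closure P Z" and j: "j \<in> {1..k}"
    have "V j \<in> dual_feasible A (B j)"
      using psd_V[OF j] assms(9)[OF j] by (simp add: dual_feasible_def)
    then have "P \<subseteq> {x. B j \<bullet> x \<le> mat_inner C (V j)}"
      using weak_duality assms(4) by blast
    then show "B j \<bullet> x \<le> real_of_int (d j)"
      using x B_Z[OF j] assms(10)[OF j] unfolding cg_closure_def by auto
  qed
  moreover have "{x. \<forall>j\<in>{1..k}. B j \<bullet> x \<le> real_of_int (d j)} \<subseteq> cg_closure P Z"
    unfolding cg_closure_def
  proof clarify
    fix x c \<delta>
    assume x: "\<forall>j\<in>{1..k}. B j \<bullet> x \<le> real_of_int (d j)"
      and c: "c \<in> Z" and valid: "P \<subseteq> {x. c \<bullet> x \<le> \<delta>}"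
    have valid': "\<And>x. x \<in> lmi_set C A \<Longrightarrow> c \<bullet> x \<le> \<delta>"
      using valid assms(4) by blast
    obtain X where opt: "dual_optimal C A c X" and "property_PZ (V ` {1..k}) X"
      using dual_optimal_exists[OF assms(1,2,6) valid'] assms(7) c
      unfolding tdi_generating_def by metis
    then obtain y :: "real^'n^'n \<Rightarrow> nat" where y: "X = (\<Sum>W\<in>V ` {1..k}. real (y W) *\<^sub>R W)"
      unfolding property_PZ_def by blast
    \<comment> \<open>\<open>V\<close> need not be injective, so each matrix gets one chosen index.\<close>
    define J where "J = inv_into {1..k} V ` (V ` {1..k})"
    have J: "J \<subseteq> {1..k}" "finite J"
      unfolding J_def by (auto simp del: atLeastAtMost_iff intro: inv_into_into)
    have X_J: "X = (\<Sum>j\<in>J. real (y (V j)) *\<^sub>R V j)"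
      unfolding y J_def
      by (subst sum.reindex) (auto intro!: sum.cong inj_on_inv_into simp: f_inv_into_f)
    define t where "t = (\<Sum>j\<in>J. int (y (V j)) * d j)"
    \<comment> \<open>The equality constraints of the dual are linear in \<open>X\<close>, so the
      decomposition of \<open>X\<close> carries over to its right-hand side
      \<open>c\<close>.\<close>
    have c_J: "c = (\<Sum>j\<in>J. real (y (V j)) *\<^sub>R B j)"
    proof -
      have "c $ i = mat_inner (A i) X" for i
        using opt by (simp add: dual_optimal_def dual_feasible_def)
      moreover have "mat_inner (A i) (V j) = B j $ i" if "j \<in> J" for i j
        using assms(9) J(1) that by auto
      ultimately show ?thesis
        by (simp add: vec_eq_iff X_J mat_inner_eq_inner inner_sum_right)
    qed
    have "c \<bullet> x = (\<Sum>j\<in>J. real (y (V j)) * (B j \<bullet> x))"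
      by (simp add: c_J inner_sum_left)
    also have "\<dots> \<le> (\<Sum>j\<in>J. real (y (V j)) * real_of_int (d j))"
      using x J(1) by (intro sum_mono mult_left_mono) auto
    also have "\<dots> = real_of_int t"
      by (simp add: t_def)
    finally have "c \<bullet> x \<le> real_of_int t" .
    have "real_of_int t = (\<Sum>j\<in>J. real (y (V j)) * real_of_int (d j))"
      by (simp add: t_def)
    also have "\<dots> \<le> (\<Sum>j\<in>J. real (y (V j)) * mat_inner C (V j))"
      using assms(10) J(1) by (intro sum_mono mult_left_mono) auto
    also have "\<dots> = mat_inner C X"
      by (simp add: X_J mat_inner_eq_inner inner_sum_right)
    also have "\<dots> \<le> \<delta>"
    \<comment> \<open>The optimal value is at most that of any feasible point, in particular one of
      value at most \<open>\<delta>\<close>.\<close>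
    proof -
      obtain Y where "Y \<in> dual_feasible A c" "mat_inner C Y \<le> \<delta>"
        using strong_duality[OF assms(1,2,6) valid'] by blast
      then show ?thesis using opt unfolding dual_optimal_def by force
    qed
    \<comment> \<open>Rounding is possible because \<open>t\<close> is an integer combination of the
      integers \<open>d j\<close>.\<close>
    finally have "t \<le> \<lfloor>\<delta>\<rfloor>" by (simp add: le_floor_iff)
    with \<open>c \<bullet> x \<le> real_of_int t\<close> show "c \<bullet> x \<le> real_of_int \<lfloor>\<delta>\<rfloor>" by linarith
  qed
  ultimately show ?thesis using B_int by blast
qed

end
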